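(* Let $(a(n))$ be the almost Golomb sequence of order $3$ and $d(n)=a(n+1)-a(n)$. For every $n\ge 3$, define the triadic block $B_n=(d(3n-2),\,d(3n-1),\,d(3n))$ and let $L_n=a(n+1)-a(n-2)$. Then for every $n\ge 3$: (i) $B_n$ is palindromic: $d(3n-2)=d(3n)$. (ii) $d(3n-2)+d(3n-1)+d(3n)=L_n$. (iii) The block $B_n$ is determined by $L_n$ as follows: $$B_n=\begin{cases}(0,1,0) & \text{if } L_n=1,\\ (1,0,1) & \text{if } L_n=2,\\ (1,1,1) & \text{if } L_n=3.\end{cases}$$ In particular, $L_n=3$ if and only if $\varepsilon(n-1)=1$.
   Context: Consider nondecreasing sequences of positive integers $(a(n))_{n\ge 1}$, extended by $a(k)=0$ for $k\le 0$, such that (1) $a\bigl(a(n)+a(n-1)+a(n-2)\bigr)=n$ for every $n\ge 1$; and (2) for every $n\ge 2$, no integer $m$ with $a(n-1)\le m<a(n)$ satisfies $a\bigl(m+a(n-1)+a(n-2)\bigr)=n$. The almost Golomb sequence of order $3$ is the earliest such sequence, i.e. the lexicographically smallest among the sequences satisfying (1) and (2). It begins $1,2,2,2,3,4,5,5,6,6,6,7,7,8,8,9,10,11,12,13,13,14,15,15,\ldots$ For $n\ge 3$, $L_n=a(n+1)-a(n-2)=d(n-2)+d(n-1)+d(n)\in\{1,2,3\}$ is the length of the run of the value $n$ in the sequence. For $k\ge 0$ let $I_k=\left[\frac{11\cdot 3^k-1}{2},\,\frac{13\cdot 3^k-3}{2}\right]\cap\mathbb{Z}$, let $\mathcal{I}=\bigcup_{k\ge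 0}I_k$, and let $\varepsilon(n)=1$ if $n\in\mathcal{I}$ and $\varepsilon(n)=0$ otherwise.
   Formalization: Condition (2) is required only for n≥3 rather than n≥2: condition (1) forces a(1)=1 and a(2)=2, so m=1 violates (2) at n=2 and no sequence would satisfy both; with n≥3 the smallest sequence is the printed one. *)

theory Defs
  imports Main
begin

(* A sequence (a(n))_{n >= 1} extended by 0 is a function on int. Condition (2) is imposed for
   n >= 3 only: for n = 2 it contradicts condition (1), see conditions_conflict_at_2 below, so
   imposing it there would leave no sequence at all. *)
definition golomb_condition :: "(int \<Rightarrow> int) \<Rightarrow> bool" where
  "golomb_condition a \<longleftrightarrow>
     (\<forall>k\<le>0. a k = 0) \<and> (\<forall>n\<ge>1. a n > 0) \<and> mono_on {1..} a \<and>
     (\<forall>n\<ge>1. a (a n + a (n - 1) + a (n - 2)) = n) \<and>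
     (\<forall>n\<ge>3. \<not> (\<exists>m. a (n - 1) \<le> m \<and> m < a n \<and> a (m + a (n - 1) + a (n - 2)) = n))"

definition lex_less :: "(int \<Rightarrow> int) \<Rightarrow> (int \<Rightarrow> int) \<Rightarrow> bool" where
  "lex_less a b \<longleftrightarrow> (\<exists>n\<ge>1. (\<forall>k\<in>{1..<n}. a k = b k) \<and> a n < b n)"

definition almost_golomb :: "(int \<Rightarrow> int) \<Rightarrow> bool" where
  "almost_golomb a \<longleftrightarrow>
     golomb_condition a \<and> (\<forall>b. golomb_condition b \<longrightarrow> b = a \<or> lex_less a b)"

definition diff :: "(int \<Rightarrow> int) \<Rightarrow> int \<Rightarrow> int" where
  "diff a n = a (n + 1) - a n"

definition run_len :: "(int \<Rightarrow> int) \<Rightarrow> int \<Rightarrow> int" where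
  "run_len a n = a (n + 1) - a (n - 2)"

definition triadic_block :: "(int \<Rightarrow> int) \<Rightarrow> int \<Rightarrow> int \<times> int \<times> int" where
  "triadic_block a n = (diff a (3 * n - 2), diff a (3 * n - 1), diff a (3 * n))"

(* Both numerators are even, so div is exact. *)
definition triadic_interval :: "nat \<Rightarrow> int set" where
  "triadic_interval k = {(11 * 3 ^ k - 1) div 2 .. (13 * 3 ^ k - 3) div 2}"

definition eps :: "int \<Rightarrow> int" where
  "eps n = (if n \<in> (\<Union>k. triadic_interval k) then 1 else 0)"

lemma conditions_conflict_at_2:
  fixes a :: "int \<Rightarrow> int"
  assumes zero: "\<forall>k\<le>0. a k = 0" and pos: "\<forall>n\<ge>1. a n > 0" and mono: "mono_on {1..} a"
    and fix_eq: "\<forall>n\<ge>1. a (a n + a (n - 1) + a (n - 2)) = n"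
  shows "\<exists>m. a (2 - 1) \<le> m \<and> m < a 2 \<and> a (m + a (2 - 1) + a (2 - 2)) = 2"
proof -
  have mono': "a i \<le> a j" if "1 \<le> i" "i \<le> j" for i j
    using mono that by (auto simp: mono_on_def)
  have z: "a 0 = 0" "a (-1) = 0" using zero by auto
  have p: "a 1 > 0" "a 2 > 0" using pos by auto
  have "a (a 1) = 1" using fix_eq[rule_format, of 1] z by simp
  then have a1: "a 1 = 1" using mono'[of 1 "a 1"] p by auto
  have e: "a (a 2 + 1) = 2" using fix_eq[rule_format, of 2] z a1 by simp
  then have ne: "a 2 \<noteq> 1" by auto
  have "a 2 \<le> 2" using mono'[of 2 "a 2 + 1"] e p by auto
  then have "a 2 = 2" using ne p by linarith
  then show ?thesis using a1 z by (intro exI[of _ 1]) simp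
qed

end

theory Submission
  imports Defs
begin

text \<open>
  Put \<open>s n = a n + a (n - 1) + a (n - 2)\<close>. Condition (1) forces the value \<open>n\<close> to occur at
  position \<open>s n\<close>, and the lexicographically smallest sequence postpones every new value \<open>n \<ge> 3\<close>
  as long as possible, that is, exactly until \<open>s n\<close>. So the value \<open>n\<close> occupies the positions
  from \<open>s n\<close> to \<open>s (n + 1) - 1\<close>, and the run length is
  \<open>s (n + 1) - s n = a (n + 1) - a (n - 2)\<close>.

  To turn this into a proof, the sequence \<open>golomb3\<close> is defined by that greedy rule
  (\<open>golomb3_rec\<close>). The point is that the rule never gets stuck: since \<open>golomb3\<close> grows by at
  most \<open>1\<close> per step, runs have length at most \<open>3\<close>; hence \<open>golomb3 k > golomb3 (k - 3)\<close>, which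
  says in turn that \<open>s\<close> is strictly increasing, so that later runs are nonempty. This
  feedback is the induction of \<open>start_bounds\<close>. It follows that \<open>golomb3\<close> satisfies the
  conditions (\<open>golomb_condition_golomb3\<close>); it is below every other solution because its values
  increase only where (1) leaves no choice (\<open>golomb3_least\<close>).

  The blocks come from applying the run description twice. If \<open>p = s n\<close>, then around \<open>p\<close> the
  sequence reads \<open>n - 1, n, \<dots>, n, n + 1\<close>, with \<open>n\<close> repeated \<open>L\<close> times. Summing three
  neighbouring entries gives the positions \<open>s p, s (p + 1), s (p + 2), \<dots>\<close> at which the values
  \<open>p, p + 1, p + 2, \<dots>\<close> start. They lie near \<open>3 n\<close>, and reading them off gives
  \<open>golomb3 (3 n - 2) = s n\<close> and the three block shapes (\<open>golomb3_blocks\<close>).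

  Finally, \<open>L = 3\<close> at \<open>n\<close> means that the differences at \<open>n - 2\<close>, \<open>n - 1\<close> and \<open>n\<close> are all \<open>1\<close>.
  The block shapes show that two adjacent ones inside one block occur only in \<open>(1, 1, 1)\<close>, so
  the centres \<open>c\<close> of triples of ones are those with \<open>(c - 1) div 3\<close> again such a centre. The
  intervals in the definition of \<open>eps\<close> obey the same recursion, starting from the
  single centre \<open>5\<close>.
\<close>

section \<open>The greedy sequence\<close>

text \<open>The test \<open>v + 1 < k\<close> always succeeds; it makes the nested recursion visibly terminating
  before anything is known about the values.\<close>

function golomb3 :: "int \<Rightarrow> int" where
  "golomb3 k =
     (if k \<le> 0 then 0 else if k = 1 then 1 else if k \<le> 4 then 2
      else let v = golomb3 (k - 1) in
        if v + 1 < k then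
          if golomb3 (v + 1) + golomb3 v + golomb3 (v - 1) \<le> k then v + 1 else v
        else v)"
  by auto
termination
  by (relation "measure nat") auto

declare golomb3.simps [simp del]

definition start :: "int \<Rightarrow> int" where
  "start n = golomb3 n + golomb3 (n - 1) + golomb3 (n - 2)"

lemma golomb3_small:
  "k \<le> 0 \<Longrightarrow> golomb3 k = 0"
  "golomb3 1 = 1" "golomb3 2 = 2" "golomb3 3 = 2" "golomb3 4 = 2"
  by (simp_all add: golomb3.simps)

lemma golomb3_step: "golomb3 (k + 1) = golomb3 k \<or> golomb3 (k + 1) = golomb3 k + 1"
proof (cases "k \<ge> 4")
  case True
  then show ?thesis
    by (subst (1 3) golomb3.simps) (simp add: Let_def)
next
  case False
  then consider "k < 0" | "k = 0" | "k = 1" | "k = 2" | "k = 3" by linarith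
  then show ?thesis by cases (simp_all add: golomb3_small)
qed

lemma golomb3_mono: "i \<le> j \<Longrightarrow> golomb3 i \<le> golomb3 j"
proof (induction j rule: int_ge_induct)
  case (step j)
  then show ?case using golomb3_step[of j] by linarith
qed simp

lemma golomb3_le: "k \<ge> 4 \<Longrightarrow> golomb3 k \<le> k - 2"
proof (induction k rule: int_ge_induct)
  case (step k)
  then show ?case using golomb3_step[of k] by linarith
qed (simp add: golomb3_small)

lemma golomb3_ge_2: "k \<ge> 2 \<Longrightarrow> golomb3 k \<ge> 2"
  using golomb3_mono[of 2 k] by (simp add: golomb3_small)

lemma golomb3_rec:
  assumes "k \<ge> 5"
  shows "golomb3 k =
    (if start (golomb3 (k - 1) + 1) \<le> k then golomb3 (k - 1) + 1 else golomb3 (k - 1))"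
proof -
  have "golomb3 (k - 1) + 1 < k"
    using golomb3_le[of "k - 1"] assms by auto
  then show ?thesis
    using assms by (subst golomb3.simps) (simp add: Let_def start_def)
qed

lemma golomb3_5_6_7: "golomb3 5 = 3" "golomb3 6 = 4" "golomb3 7 = 5"
proof -
  show g5: "golomb3 5 = 3" by (simp add: golomb3_rec start_def golomb3_small)
  show g6: "golomb3 6 = 4" by (simp add: golomb3_rec start_def golomb3_small g5)
  show "golomb3 7 = 5" by (simp add: golomb3_rec start_def golomb3_small g5 g6)
qed

lemma start_small: "start 1 = 1" "start 2 = 3" "start 3 = 5"
  by (simp_all add: start_def golomb3_small)

section \<open>Runs of the greedy sequence\<close>

lemma start_Suc_diff: "start (n + 1) - start n = golomb3 (n + 1) - golomb3 (n - 2)"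
  by (simp add: start_def algebra_simps)

lemma start_Suc_le: "start (n + 1) \<le> start n + 3"
  using start_Suc_diff[of n] golomb3_step[of n] golomb3_step[of "n - 1"] golomb3_step[of "n - 2"]
  by auto

text \<open>Four equal consecutive entries would be a run of length at least \<open>4\<close>, but runs are no longer
  than the growth over three steps, which is at most \<open>3\<close>.\<close>

lemma golomb3_gt_if_start_bounds:
  assumes j: "j \<ge> 4"
    and bounds: "\<And>i. 4 \<le> i \<Longrightarrow> i \<le> j \<Longrightarrow> start (golomb3 i) \<le> i \<and> i < start (golomb3 i + 1)"
  shows "golomb3 (j - 3) < golomb3 j"
proof (cases "j \<ge> 7")
  case True
  show ?thesis
  proof (rule ccontr)
    assume "\<not> ?thesis"
    then have "golomb3 (j - 3) = golomb3 j" using golomb3_mono[of "j - 3" j] by simp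
    then show False
      using bounds[of "j - 3"] bounds[of j] True start_Suc_le[of "golomb3 j"] by simp
  qed
next
  case False
  then consider "j = 4" | "j = 5" | "j = 6" using j by linarith
  then show ?thesis by cases (simp_all add: golomb3_small golomb3_5_6_7)
qed

text \<open>When the value \<open>v + 1\<close> has just been introduced at \<open>k\<close>, the start of \<open>v + 2\<close> must lie
  strictly beyond \<open>k\<close>. This amounts to a strict increase over three steps ending at \<open>v + 2\<close>,
  and since \<open>v + 2 < k\<close> the induction hypothesis provides it.\<close>

lemma start_bounds:
  assumes "k \<ge> 4"
  shows "start (golomb3 k) \<le> k \<and> k < start (golomb3 k + 1)"
  using assms
proof (induction "nat k" arbitrary: k rule: less_induct)
  case less
  show ?case
  proof (cases "k = 4")
    case True
    then show ?thesis by (simp add: golomb3_small start_small)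
  next
    case False
    then have k: "k \<ge> 5" using less.prems by simp
    have IH: "start (golomb3 i) \<le> i \<and> i < start (golomb3 i + 1)" if "4 \<le> i" "i < k" for i
      using less.hyps that by simp
    define v where "v = golomb3 (k - 1)"
    have v: "v \<ge> 2" "v + 3 \<le> k"
      using golomb3_ge_2[of "k - 1"] golomb3_le[of "k - 1"] k by (auto simp: v_def)
    have prev: "start v \<le> k - 1" "k - 1 < start (v + 1)"
      using IH[of "k - 1"] k by (simp_all add: v_def)
    show ?thesis
    proof (cases "start (v + 1) \<le> k")
      case True
      have "golomb3 (v + 2 - 3) < golomb3 (v + 2)"
        using v IH by (intro golomb3_gt_if_start_bounds) auto
      then have "start (v + 1) < start (v + 2)"
        using start_Suc_diff[of "v + 1"] by (simp add: algebra_simps)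
      then show ?thesis
        using True prev golomb3_rec[OF k] by (simp add: v_def add.assoc)
    next
      case False
      then show ?thesis using prev golomb3_rec[OF k] by (simp add: v_def)
    qed
  qed
qed

lemma golomb3_strict: "j \<ge> 4 \<Longrightarrow> golomb3 (j - 3) < golomb3 j"
  by (rule golomb3_gt_if_start_bounds) (use start_bounds in auto)

lemma start_less_Suc:
  assumes "n \<ge> 1"
  shows "start n < start (n + 1)"
proof (cases "n \<ge> 3")
  case True
  then show ?thesis using start_Suc_diff[of n] golomb3_strict[of "n + 1"] by simp
next
  case False
  then have "n = 1 \<or> n = 2" using assms by linarith
  then show ?thesis by (auto simp: start_small)
qed

lemma start_strict_mono:
  assumes "1 \<le> m" "m < n"
  shows "start m < start n"
proof -
  have "m + 1 \<le> n" using assms by simp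
  then show ?thesis
  proof (induction n rule: int_ge_induct)
    case base
    then show ?case using start_less_Suc assms by simp
  next
    case (step i)
    then show ?case using start_less_Suc[of i] assms by simp
  qed
qed

lemma golomb3_eqI:
  assumes "n \<ge> 1" "k \<ge> 4" "start n \<le> k" "k < start (n + 1)"
  shows "golomb3 k = n"
proof (rule ccontr)
  assume ne: "golomb3 k \<noteq> n"
  have k: "start (golomb3 k) \<le> k" "k < start (golomb3 k + 1)"
    using start_bounds assms by auto
  have pos: "golomb3 k \<ge> 2" using golomb3_ge_2 assms by simp
  consider "golomb3 k + 1 = n" | "golomb3 k + 1 < n" | "n + 1 = golomb3 k" | "n + 1 < golomb3 k"
    using ne by linarith
  then show False
    using k pos assms start_strict_mono[of "golomb3 k + 1" n] start_strict_mono[of "n + 1" "golomb3 k"]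
    by cases auto
qed

lemma start_ge_5: "n \<ge> 3 \<Longrightarrow> start n \<ge> 5"
  using start_strict_mono[of 3 n] by (cases "n = 3") (simp_all add: start_small)

section \<open>The greedy sequence is the almost Golomb sequence\<close>

lemma golomb_condition_golomb3: "golomb_condition golomb3"
  unfolding golomb_condition_def
proof (intro conjI allI impI notI)
  fix n :: int
  show "golomb3 n = 0" if "n \<le> 0" using that by (rule golomb3_small)
  show "golomb3 n > 0" if "n \<ge> 1"
    using golomb3_mono[of 1 n] that by (simp add: golomb3_small)
  show "mono_on {1..} golomb3" by (simp add: mono_on_def golomb3_mono)
  show "golomb3 (golomb3 n + golomb3 (n - 1) + golomb3 (n - 2)) = n" if "n \<ge> 1"
  proof (cases "n \<ge> 3")
    case True
    then show ?thesis
      using golomb3_eqI[of n "start n"] start_ge_5[of n] start_less_Suc[of n]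
      by (simp add: start_def)
  next
    case False
    then have "n = 1 \<or> n = 2" using that by linarith
    then show ?thesis by (auto simp: golomb3_small)
  qed
next
  fix n :: int
  assume n: "n \<ge> 3"
    and "\<exists>m. golomb3 (n - 1) \<le> m \<and> m < golomb3 n \<and> golomb3 (m + golomb3 (n - 1) + golomb3 (n - 2)) = n"
  then obtain m where m: "golomb3 (n - 1) \<le> m" "m < golomb3 n"
    and eq: "golomb3 (m + golomb3 (n - 1) + golomb3 (n - 2)) = n" by blast
  have "golomb3 (n - 1) \<ge> 2" "golomb3 (n - 2) \<ge> 1"
    using n golomb3_ge_2[of "n - 1"] golomb3_mono[of 1 "n - 2"] by (auto simp: golomb3_small)
  then have "start n \<le> m + golomb3 (n - 1) + golomb3 (n - 2)"
    using start_bounds[of "m + golomb3 (n - 1) + golomb3 (n - 2)"] m eq by simp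
  then show False using m by (simp add: start_def)
qed

text \<open>The greedy rule increases only at \<open>k \<ge> start v\<close> for the new value \<open>v\<close>. As \<open>start v\<close> depends
  only on earlier entries, a solution that agrees with \<open>golomb3\<close> so far has the value \<open>v\<close> at
  \<open>start v\<close> as well, and hence at least \<open>v\<close> at \<open>k\<close>.\<close>

lemma golomb3_least:
  assumes b: "golomb_condition b" and k: "k \<ge> 1"
    and agree: "\<And>i. i < k \<Longrightarrow> b i = golomb3 i"
  shows "golomb3 k \<le> b k"
proof -
  have pos: "b n > 0" if "n \<ge> 1" for n using b that by (simp add: golomb_condition_def)
  have mono: "b i \<le> b j" if "1 \<le> i" "i \<le> j" for i j
    using b that by (auto simp: golomb_condition_def mono_on_def)
  have hit: "b (b n + b (n - 1) + b (n - 2)) = n" if "n \<ge> 1" for n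
    using b that by (simp add: golomb_condition_def)
  consider "k = 1" | "k = 2" | "k = 3 \<or> k = 4" | "k \<ge> 5" using k by linarith
  then show ?thesis
  proof cases
    case 1
    then show ?thesis using pos[of 1] by (simp add: golomb3_small)
  next
    case 2
    \<comment> \<open>\<open>b 2 = 1\<close> would give \<open>2 = b (b 2 + b 1) = b 2\<close>.\<close>
    have "b (b 2 + 1) = 2"
      using hit[of 2] agree[of 1] agree[of 0] 2 by (simp add: golomb3_small)
    then have "b 2 \<noteq> 1" by auto
    then show ?thesis using 2 pos[of 2] by (simp add: golomb3_small)
  next
    case 3
    then have "b 2 \<le> b k" "b 2 = 2" using mono[of 2 k] agree[of 2] by (auto simp: golomb3_small)
    then show ?thesis using 3 by (auto simp: golomb3_small)
  next
    case 4
    define v where "v = golomb3 (k - 1)"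
    have v: "v \<ge> 2" "v + 3 \<le> k"
      using golomb3_ge_2[of "k - 1"] golomb3_le[of "k - 1"] 4 by (auto simp: v_def)
    have "v \<le> b k" using mono[of "k - 1" k] agree[of "k - 1"] 4 by (simp add: v_def)
    moreover have "v + 1 \<le> b k" if "start (v + 1) \<le> k"
    proof -
      have "b (start (v + 1)) = v + 1"
        using hit[of "v + 1"] agree v by (simp add: start_def)
      moreover have "1 \<le> start (v + 1)" using start_ge_5[of "v + 1"] v by simp
      ultimately show ?thesis using mono[OF _ that] by simp
    qed
    ultimately show ?thesis using golomb3_rec[OF 4] by (auto simp: v_def)
  qed
qed

lemma lex_less_golomb3:
  assumes b: "golomb_condition b" and ne: "b \<noteq> golomb3"
  shows "lex_less golomb3 b"
proof -
  have nonpos: "b k = golomb3 k" if "k \<le> 0" for k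
    using b that by (simp add: golomb_condition_def golomb3_small)
  obtain x where "b x \<noteq> golomb3 x" using ne by blast
  then have "\<exists>i::nat. b (int i) \<noteq> golomb3 (int i)"
    using nonpos[of x] by (intro exI[of _ "nat x"]) (cases "x \<le> 0", auto)
  then obtain i :: nat where i: "b (int i) \<noteq> golomb3 (int i)"
    and least: "\<And>j. j < i \<Longrightarrow> b (int j) = golomb3 (int j)"
    using exists_least_iff[of "\<lambda>i::nat. b (int i) \<noteq> golomb3 (int i)"] by blast
  have agree: "b j = golomb3 j" if "j < int i" for j
    using nonpos[of j] least[of "nat j"] that by (cases "j \<le> 0") auto
  have "int i \<ge> 1" using i nonpos[of 0] by (cases i) auto
  then show ?thesis
    using golomb3_least[OF b _ agree] i agree unfolding lex_less_def
    by (intro exI[of _ "int i"]) (auto simp: less_le)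
qed

lemma lex_less_asym: "lex_less a b \<Longrightarrow> \<not> lex_less b a"
proof
  assume "lex_less a b" "lex_less b a"
  then obtain m n where
    m: "m \<ge> 1" "\<forall>k\<in>{1..<m}. a k = b k" "a m < b m" and
    n: "n \<ge> 1" "\<forall>k\<in>{1..<n}. b k = a k" "b n < a n"
    unfolding lex_less_def by blast
  then show False by (cases m n rule: linorder_cases) auto
qed

lemma almost_golomb_imp_golomb3:
  assumes "almost_golomb a"
  shows "a = golomb3"
proof (rule ccontr)
  assume "a \<noteq> golomb3"
  then have "lex_less golomb3 a" "lex_less a golomb3"
    using assms lex_less_golomb3 golomb_condition_golomb3 by (auto simp: almost_golomb_def)
  then show False using lex_less_asym by blast
qed

section \<open>Triadic blocks\<close>

lemma run_len_golomb3: "run_len golomb3 n = start (n + 1) - start n"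
  by (simp add: run_len_def start_Suc_diff)

lemma run_len_sum:
  "run_len golomb3 n = diff golomb3 (n - 2) + diff golomb3 (n - 1) + diff golomb3 n"
  by (simp add: run_len_def diff_def)

lemma diff_golomb3_cases: "diff golomb3 n = 0 \<or> diff golomb3 n = 1"
  using golomb3_step[of n] by (auto simp: diff_def)

lemma run_len_bounds:
  assumes "n \<ge> 1"
  shows "1 \<le> run_len golomb3 n" "run_len golomb3 n \<le> 3"
  using start_less_Suc[OF assms] start_Suc_le[of n] by (auto simp: run_len_golomb3)

text \<open>At \<open>p = start n\<close> the sequence steps from \<open>n - 1\<close> to \<open>n\<close>. Summing three entries ending just at
  or just after this step gives \<open>start p \<le> (n - 1) + (n - 1) + n\<close> and
  \<open>start (p + 1) \<ge> (n - 1) + n + n\<close>, so \<open>3 * n - 2\<close> lies in the run of \<open>p\<close>.\<close>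

lemma golomb3_triadic:
  assumes "n \<ge> 3"
  shows "golomb3 (3 * n - 2) = start n"
proof -
  define p where "p = start n"
  have p: "p \<ge> 5" using start_ge_5 assms by (simp add: p_def)
  have L: "start n < start (n + 1)" "start (n - 1) < start n"
    using assms start_less_Suc[of n] start_less_Suc[of "n - 1"] by simp_all
  have at: "golomb3 p = n" "golomb3 (p - 1) = n - 1"
    using assms L p golomb3_eqI[of n p] golomb3_eqI[of "n - 1" "p - 1"] by (simp_all add: p_def)
  have "start p \<le> 3 * n - 2"
    using at golomb3_mono[of "p - 2" "p - 1"] by (simp add: start_def)
  moreover have "3 * n - 2 < start (p + 1)"
    using at golomb3_mono[of p "p + 1"] by (simp add: start_def)
  ultimately have "golomb3 (3 * n - 2) = p"
    using assms p by (intro golomb3_eqI) auto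
  then show ?thesis by (simp add: p_def)
qed

text \<open>The positions where the values \<open>p + 1\<close> and \<open>p + 2\<close> start, for \<open>p = start n\<close>, are sums of
  entries taken from the run of \<open>n\<close> and its neighbours; the longer the run, the
  earlier these positions come.\<close>

lemma golomb3_blocks:
  assumes "n \<ge> 3"
  shows "triadic_block golomb3 n =
    (if run_len golomb3 n = 1 then (0, 1, 0)
     else if run_len golomb3 n = 2 then (1, 0, 1) else (1, 1, 1))"
proof -
  define p where "p = start n"
  define L where "L = run_len golomb3 n"
  have p: "p \<ge> 5" using start_ge_5 assms by (simp add: p_def)
  have next_start: "start (n + 1) = p + L" by (simp add: run_len_golomb3 L_def p_def)
  have next_next: "p + L < start (n + 1 + 1)"
    using start_less_Suc[of "n + 1"] next_start assms by simp
  have ends: "golomb3 (3 * n - 2) = p" "golomb3 (3 * n + 1) = p + L"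
    using golomb3_triadic[of n] golomb3_triadic[of "n + 1"] next_start assms
    by (simp_all add: p_def add.commute)
  have run: "golomb3 (p + i) = n" if "0 \<le> i" "i < L" for i
    using that assms p next_start by (intro golomb3_eqI) (auto simp: p_def)
  have after: "golomb3 (p + L) = n + 1"
    using next_start next_next assms p start_less_Suc[of n]
    by (intro golomb3_eqI) (auto simp: p_def)
  have value_at: "golomb3 k = q" if "start q \<le> k" "k < start (q + 1)" "p \<le> q" "4 \<le> k" for k q
    using that p by (intro golomb3_eqI) auto
  have prev: "golomb3 (p - 1) = n - 1"
    using assms start_less_Suc[of "n - 1"] p by (intro golomb3_eqI) (auto simp: p_def)
  have s1: "start (p + 1) = golomb3 (p + 1) + golomb3 p + golomb3 (p - 1)"
    and s2: "start (p + 1 + 1) = golomb3 (p + 2) + golomb3 (p + 1) + golomb3 p"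
    by (simp_all add: start_def add.commute)
  have s12: "start (p + 1) < start (p + 1 + 1)" and s23: "start (p + 2) < start (p + 2 + 1)"
    using start_less_Suc[of "p + 1"] start_less_Suc[of "p + 2"] p by simp_all
  have s0: "start p \<le> 3 * n - 2"
    using start_bounds[of "3 * n - 2"] ends assms by simp
  have "1 \<le> L" "L \<le> 3" using run_len_bounds assms by (simp_all add: L_def)
  then consider "L = 1" | "L = 2" | "L = 3" by linarith
  then have "triadic_block golomb3 n =
    (if L = 1 then (0, 1, 0) else if L = 2 then (1, 0, 1) else (1, 1, 1))"
  proof cases
    case 1
    have "start (p + 1) = 3 * n" using s1 run[of 0] after prev 1 by simp
    then have "golomb3 (3 * n - 1) = p" "golomb3 (3 * n) = p + 1"
      using s0 s12 assms by (auto intro!: value_at)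
    then show ?thesis using ends 1 by (simp add: triadic_block_def diff_def)
  next
    case 2
    have "start (p + 1) = 3 * n - 1" "start (p + 1 + 1) = 3 * n + 1"
      using s1 s2 run[of 0] run[of 1] after prev 2 by simp_all
    then have "golomb3 (3 * n - 1) = p + 1" "golomb3 (3 * n) = p + 1"
      using assms by (auto intro!: value_at)
    then show ?thesis using ends 2 by (simp add: triadic_block_def diff_def)
  next
    case 3
    have "start (p + 1) = 3 * n - 1" "start (p + 1 + 1) = 3 * n"
      using s1 s2 run[of 0] run[of 1] run[of 2] prev 3 by simp_all
    then have "golomb3 (3 * n - 1) = p + 1" "golomb3 (3 * n) = p + 2"
      using s23 assms by (auto intro!: value_at simp: add.assoc)
    then show ?thesis using ends 3 by (simp add: triadic_block_def diff_def)
  qed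
  then show ?thesis by (simp add: L_def)
qed

section \<open>Runs of length three\<close>

lemma triadic_interval_0: "triadic_interval 0 = {5}"
  by (simp add: triadic_interval_def)

lemma triadic_interval_Suc:
  "c \<in> triadic_interval (Suc k) \<longleftrightarrow> (c - 1) div 3 \<in> triadic_interval k"
proof -
  have "odd ((3::int) ^ k)" by simp
  then obtain t where t: "(3::int) ^ k = 2 * t + 1" by (rule oddE)
  have "triadic_interval k = {11 * t + 5 .. 13 * t + 5}"
    "triadic_interval (Suc k) = {33 * t + 16 .. 39 * t + 18}"
    by (simp_all add: triadic_interval_def t algebra_simps)
  moreover have "33 * t + 16 \<le> c \<longleftrightarrow> 11 * t + 5 \<le> (c - 1) div 3"
    "c \<le> 39 * t + 18 \<longleftrightarrow> (c - 1) div 3 \<le> 13 * t + 5"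
    by linarith+
  ultimately show ?thesis by simp
qed

lemma triadic_union_rec:
  "c \<in> (\<Union>k. triadic_interval k) \<longleftrightarrow> c = 5 \<or> (c - 1) div 3 \<in> (\<Union>k. triadic_interval k)"
proof -
  have "c \<in> (\<Union>k. triadic_interval k) \<longleftrightarrow>
    c \<in> triadic_interval 0 \<or> (\<exists>k. c \<in> triadic_interval (Suc k))"
    using not0_implies_Suc by (metis UNIV_I UN_iff)
  then show ?thesis by (simp add: triadic_interval_0 triadic_interval_Suc)
qed

lemma triadic_union_ge_5: "c \<in> (\<Union>k. triadic_interval k) \<Longrightarrow> c \<ge> 5"
proof -
  have "5 \<le> (11 * (3::int) ^ k - 1) div 2" for k
  proof -
    have "1 \<le> (3::int) ^ k" by simp
    then show ?thesis by linarith
  qed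
  then show "c \<in> (\<Union>k. triadic_interval k) \<Longrightarrow> c \<ge> 5"
    by (fastforce simp: triadic_interval_def intro: order_trans)
qed

text \<open>Three consecutive ones contain two adjacent ones of one block, which is then \<open>(1, 1, 1)\<close>. For
  the converse, a triple that overlaps \<open>(1, 1, 1)\<close> in only two places also needs a one at the near
  end of the neighbouring block; this holds because runs next to a run of length \<open>3\<close> have length at
  least \<open>2\<close>, as the windows of differences that determine them overlap in two places.\<close>

lemma run_len_3_rec:
  assumes "c \<ge> 8"
  shows "run_len golomb3 (c + 1) = 3 \<longleftrightarrow> run_len golomb3 ((c - 1) div 3 + 1) = 3"
proof -
  define m where "m = (c - 1) div 3 + 1"
  have m: "m \<ge> 3" using assms by (simp add: m_def)
  have block: "diff golomb3 (3 * n - 2) = (if run_len golomb3 n = 1 then 0 else 1)"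
    "diff golomb3 (3 * n - 1) = (if run_len golomb3 n = 2 then 0 else 1)"
    "diff golomb3 (3 * n) = (if run_len golomb3 n = 1 then 0 else 1)" if "n \<ge> 3" for n
    using golomb3_blocks[OF that] by (auto simp: triadic_block_def split: if_splits)
  have centre: "run_len golomb3 (c + 1) = 3 \<longleftrightarrow>
      diff golomb3 (c - 1) = 1 \<and> diff golomb3 c = 1 \<and> diff golomb3 (c + 1) = 1"
    using run_len_sum[of "c + 1"] diff_golomb3_cases[of "c - 1"] diff_golomb3_cases[of c]
      diff_golomb3_cases[of "c + 1"] by auto
  have Lm: "1 \<le> run_len golomb3 m" "run_len golomb3 m \<le> 3" using run_len_bounds m by auto
  have overlap: "run_len golomb3 (m + 1) \<noteq> 1" "run_len golomb3 (m - 1) \<noteq> 1"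
    if "run_len golomb3 m = 3"
    using that run_len_sum[of m] run_len_sum[of "m + 1"] run_len_sum[of "m - 1"]
      diff_golomb3_cases[of "m - 3"] diff_golomb3_cases[of "m - 2"] diff_golomb3_cases[of "m - 1"]
      diff_golomb3_cases[of m] diff_golomb3_cases[of "m + 1"]
    by auto
  have "c = 3 * m - 2 \<or> c = 3 * m - 1 \<or> c = 3 * m" unfolding m_def by presburger
  then consider "c = 3 * m - 2" | "c = 3 * m - 1" | "c = 3 * m" by blast
  then have "run_len golomb3 (c + 1) = 3 \<longleftrightarrow> run_len golomb3 m = 3"
  proof cases
    case 1
    then have "m - 1 \<ge> 3" using assms by simp
    then show ?thesis
      using 1 m centre block(1,2)[of m] block(3)[of "m - 1"] overlap Lm by (auto split: if_splits)
  next
    case 2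
    then show ?thesis using m centre block[of m] Lm by (auto split: if_splits)
  next
    case 3
    then show ?thesis
      using m centre block(2,3)[of m] block(1)[of "m + 1"] overlap Lm
      by (auto simp: add.commute split: if_splits)
  qed
  then show ?thesis by (simp add: m_def)
qed

lemma run_len_3_iff_triadic:
  assumes "c \<ge> 2"
  shows "run_len golomb3 (c + 1) = 3 \<longleftrightarrow> c \<in> (\<Union>k. triadic_interval k)"
  using assms
proof (induction "nat c" arbitrary: c rule: less_induct)
  case less
  show ?case
  proof (cases "c \<ge> 8")
    case True
    then have "2 \<le> (c - 1) div 3" "(c - 1) div 3 < c" by linarith+
    then have "run_len golomb3 ((c - 1) div 3 + 1) = 3 \<longleftrightarrow>
        (c - 1) div 3 \<in> (\<Union>k. triadic_interval k)"
      using less.hyps[of "(c - 1) div 3"] by simp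
    then show ?thesis using run_len_3_rec[OF True] triadic_union_rec[of c] True by auto
  next
    case False
    have "(c - 1) div 3 < 5" using False by simp
    then have "c \<in> (\<Union>k. triadic_interval k) \<longleftrightarrow> c = 5"
      using triadic_union_rec[of c] triadic_union_ge_5[of "(c - 1) div 3"] by auto
    moreover have g8: "golomb3 8 = 5"
      by (simp add: golomb3_rec start_def golomb3_small golomb3_5_6_7)
    have "c = 2 \<or> c = 3 \<or> c = 4 \<or> c = 5 \<or> c = 6 \<or> c = 7"
      using False less.prems by linarith
    then have "run_len golomb3 (c + 1) = 3 \<longleftrightarrow> c = 5"
      using golomb3_step[of 8] by (auto simp: run_len_def golomb3_small golomb3_5_6_7 g8)
    ultimately show ?thesis by simp
  qed
qed

theorem proposition8p5:
  fixes a :: "int \<Rightarrow> int" and n :: int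
  assumes "almost_golomb a" and "n \<ge> 3"
  shows "diff a (3 * n - 2) = diff a (3 * n)
    \<and> diff a (3 * n - 2) + diff a (3 * n - 1) + diff a (3 * n) = run_len a n
    \<and> run_len a n \<in> {1, 2, 3}
    \<and> (run_len a n = 1 \<longrightarrow> triadic_block a n = (0, 1, 0))
    \<and> (run_len a n = 2 \<longrightarrow> triadic_block a n = (1, 0, 1))
    \<and> (run_len a n = 3 \<longrightarrow> triadic_block a n = (1, 1, 1))
    \<and> (run_len a n = 3 \<longleftrightarrow> eps (n - 1) = 1)"
proof -
  have a: "a = golomb3" using assms(1) by (rule almost_golomb_imp_golomb3)
  have "1 \<le> run_len a n" "run_len a n \<le> 3" using run_len_bounds[of n] assms(2) a by simp_all
  then have L: "run_len a n = 1 \<or> run_len a n = 2 \<or> run_len a n = 3" by linarith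
  have block: "triadic_block a n =
    (if run_len a n = 1 then (0, 1, 0) else if run_len a n = 2 then (1, 0, 1) else (1, 1, 1))"
    using golomb3_blocks[OF assms(2)] a by simp
  have "run_len a n = 3 \<longleftrightarrow> eps (n - 1) = 1"
    using run_len_3_iff_triadic[of "n - 1"] assms(2) a by (simp add: eps_def)
  then show ?thesis using L block by (auto simp: triadic_block_def)
qed

end
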